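(* For every graph $G$, $\mathbf{tw}_\alpha(G)\le\overline{\mathbf{tw}}(G)$.
   Context: A graph $G$ is a finite vertex set $V(G)$ with a symmetric irreflexive edge relation; $\mathbf{Gr}$ is the category of graphs and edge-preserving vertex maps. A tree is a nonempty connected graph without cycles. For a graph $T$, the category $\int T$ has as objects the vertices and the (unordered) edges of $T$, with only non-identity morphisms $e_x:e\to x$ and $e_y:e\to y$ for each edge $e=xy$. A tree decomposition of $G$ is here a functor $d:\int T\to\mathbf{Gr}$, $T$ a tree, sending every morphism to a monomorphism (an injective homomorphism), with $\operatorname{colim} d\cong G$; the graphs $d(t)$, $t\in V(T)$, are its bags. The independence number $\alpha(G)$ is the largest cardinality of a set of pairwise non-adjacent vertices of $G$. The tree independence number of a tree decomposition $d:\int T\to\mathbf{Gr}$ is $\max_{t\in V(T)}\alpha(d(t))-1$, and the tree independence number $\mathbf{tw}_\alpha(G)$ is the minimum of this over all tree decompositions of $G$. The complemented treewidth is $\overline{\mathbf{tw}}(G)=\mathbf{tw}(\overline{G})$, where $\overline{G}$ is the complement graph of $G$ and $\mathbf{tw}$ is usual treewidth: the minimum of $\max_t|X(t)|-1$ over all pairs $(X,T)$ with $T$ a tree and $X:V(T)\to P(V(G))$ such that the $X(t)$ cover $V(G)$, every edge of $G$ has both ends in some $X(t)$, and $X(t_1)\cap X(t_3)\subseteq X(t_2)$ whenever $t_2$ lies on the path between $t_1$ and $t_3$ in $T$. *)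

theory Defs
  imports Complex_Main "Graph_Theory.Graph_Theory"
begin

text \<open>
  A graph is a \<^typ>\<open>'a pair_pre_digraph\<close> satisfying \<^locale>\<open>pair_graph\<close>: a finite vertex set with a
  symmetric irreflexive relation on it. The empty graph is allowed.
\<close>

text \<open>
  The library's \<^const>\<open>tree\<close> counts the walk \<open>u, v, u\<close> along a single undirected edge as a cycle,
  so it is not usable for symmetric digraphs: here cycles have length at least 3. Nonemptiness is
  part of \<^const>\<open>connected\<close>.
\<close>

definition undirected_tree :: "'t pair_pre_digraph \<Rightarrow> bool" where
  "undirected_tree T \<longleftrightarrow> pair_graph T \<and> connected (with_proj T) \<and>
     (\<nexists>p. pre_digraph.cycle (with_proj T) p \<and> 3 \<le> length p)"

definition complement_graph :: "'a pair_pre_digraph \<Rightarrow> 'a pair_pre_digraph" where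
  "complement_graph G = \<lparr> pverts = pverts G,
     parcs = {(u, v). u \<in> pverts G \<and> v \<in> pverts G \<and> u \<noteq> v \<and> (u, v) \<notin> parcs G} \<rparr>"

definition independent_set :: "'a pair_pre_digraph \<Rightarrow> 'a set \<Rightarrow> bool" where
  "independent_set G S \<longleftrightarrow> S \<subseteq> pverts G \<and> (\<forall>u\<in>S. \<forall>v\<in>S. (u, v) \<notin> parcs G)"

definition independence_number :: "'a pair_pre_digraph \<Rightarrow> nat" where
  "independence_number G = Max {card S |S. independent_set G S}"

definition graph_hom :: "('a \<Rightarrow> 'b) \<Rightarrow> 'a pair_pre_digraph \<Rightarrow> 'b pair_pre_digraph \<Rightarrow> bool" where
  "graph_hom f G H \<longleftrightarrow> f ` pverts G \<subseteq> pverts H \<and> (\<forall>(u, v)\<in>parcs G. (f u, f v) \<in> parcs H)"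

definition graph_mono :: "('a \<Rightarrow> 'b) \<Rightarrow> 'a pair_pre_digraph \<Rightarrow> 'b pair_pre_digraph \<Rightarrow> bool" where
  "graph_mono f G H \<longleftrightarrow> graph_hom f G H \<and> inj_on f (pverts G)"

text \<open>
  Objects of the category \<open>\<integral>T\<close>. An unordered edge is represented by the set of its two ends.
\<close>

datatype 't elt = Vertex 't | Edge "'t set"

definition elts :: "'t pair_pre_digraph \<Rightarrow> 't elt set" where
  "elts T = Vertex ` pverts T \<union> {Edge {x, y} |x y. (x, y) \<in> parcs T}"

text \<open>
  A functor from \<open>\<integral>T\<close> to graphs: \<open>ob d\<close> is its action on objects and \<open>mor d e x\<close> is the image of
  the non-identity morphism \<open>e_x : e \<rightarrow> x\<close>. No two non-identity morphisms of \<open>\<integral>T\<close> are composable, so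
  functoriality imposes no equations on these data.
\<close>

record ('t, 'b) diagram =
  ob :: "'t elt \<Rightarrow> 'b pair_pre_digraph"
  mor :: "'t set \<Rightarrow> 't \<Rightarrow> 'b \<Rightarrow> 'b"

text \<open>As \<^term>\<open>parcs T\<close> is symmetric, the second conjunct covers both ends of each edge.\<close>

definition monic_diagram :: "'t pair_pre_digraph \<Rightarrow> ('t, 'b) diagram \<Rightarrow> bool" where
  "monic_diagram T d \<longleftrightarrow> (\<forall>a\<in>elts T. pair_graph (ob d a)) \<and>
     (\<forall>(x, y)\<in>parcs T. graph_mono (mor d {x, y} x) (ob d (Edge {x, y})) (ob d (Vertex x)))"

definition cocone ::
  "'t pair_pre_digraph \<Rightarrow> ('t, 'b) diagram \<Rightarrow> ('t elt \<Rightarrow> 'b \<Rightarrow> 'h) \<Rightarrow> 'h pair_pre_digraph \<Rightarrow> bool" where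
  "cocone T d c H \<longleftrightarrow> pair_graph H \<and> (\<forall>a\<in>elts T. graph_hom (c a) (ob d a) H) \<and>
     (\<forall>(x, y)\<in>parcs T. \<forall>v\<in>pverts (ob d (Edge {x, y})).
        c (Vertex x) (mor d {x, y} x v) = c (Edge {x, y}) v)"

definition mediating ::
  "'t pair_pre_digraph \<Rightarrow> ('t, 'b) diagram \<Rightarrow> ('t elt \<Rightarrow> 'b \<Rightarrow> 'g) \<Rightarrow> 'g pair_pre_digraph \<Rightarrow>
   ('t elt \<Rightarrow> 'b \<Rightarrow> 'h) \<Rightarrow> 'h pair_pre_digraph \<Rightarrow> ('g \<Rightarrow> 'h) \<Rightarrow> bool" where
  "mediating T d c G c' H h \<longleftrightarrow> graph_hom h G H \<and>
     (\<forall>a\<in>elts T. \<forall>v\<in>pverts (ob d a). h (c a v) = c' a v)"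

text \<open>
  The test objects \<open>H\<close> have natural numbers as vertices, because a type variable cannot be quantified
  inside a definition. Graphs being finite, this is no restriction; see the lemma below.
  Maps are total HOL functions, so uniqueness is uniqueness on the vertices of \<open>G\<close>.
\<close>

definition is_colimit ::
  "'t pair_pre_digraph \<Rightarrow> ('t, 'b) diagram \<Rightarrow> ('t elt \<Rightarrow> 'b \<Rightarrow> 'g) \<Rightarrow> 'g pair_pre_digraph \<Rightarrow> bool" where
  "is_colimit T d c G \<longleftrightarrow> cocone T d c G \<and>
     (\<forall>(H :: nat pair_pre_digraph) c'. cocone T d c' H \<longrightarrow>
        (\<exists>h. mediating T d c G c' H h \<and>
           (\<forall>h'. mediating T d c G c' H h' \<longrightarrow> (\<forall>v\<in>pverts G. h' v = h v))))"

lemma is_colimit_universal: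
  fixes H :: "'h pair_pre_digraph"
  assumes col: "is_colimit T d c G" and coc: "cocone T d c' H"
  shows "\<exists>h. mediating T d c G c' H h \<and>
           (\<forall>h'. mediating T d c G c' H h' \<longrightarrow> (\<forall>v\<in>pverts G. h' v = h v))"
proof -
  interpret H: pair_graph H using coc by (simp add: cocone_def)
  obtain f :: "'h \<Rightarrow> nat" where f: "inj_on f (pverts H)"
    using finite_imp_inj_to_nat_seg[OF H.pair_finite_verts] by blast
  define g where "g = inv_into (pverts H) f"
  have gf: "g (f x) = x" if "x \<in> pverts H" for x using f that by (simp add: g_def)
  define H' where "H' = \<lparr> pverts = f ` pverts H, parcs = (\<lambda>(u, v). (f u, f v)) ` parcs H \<rparr>"
  have arcs: "u \<in> pverts H" "v \<in> pverts H" if "(u, v) \<in> parcs H" for u v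
    using that H.in_arcsD1 H.in_arcsD2 by auto
  have "pair_graph H'"
  proof
    show "symmetric (with_proj H')"
      using H.pair_sym_arcs unfolding symmetric_def sym_def H'_def with_proj_simps
      by (auto intro: rev_image_eqI)
    fix e assume "e \<in> parcs H'"
    then obtain u v where uv: "(u, v) \<in> parcs H" "e = (f u, f v)" by (auto simp: H'_def)
    with arcs[OF uv(1)] H.pair_no_loops[OF uv(1)] f
    show "fst e \<in> pverts H'" "snd e \<in> pverts H'" "fst e \<noteq> snd e"
      by (auto simp: H'_def dest: inj_onD)
  qed (auto simp: H'_def H.pair_finite_verts H.pair_finite_arcs)
  moreover have hom_comp: "graph_hom (\<lambda>v. f (k v)) K H'" if "graph_hom k K H" for k K
    using that unfolding graph_hom_def H'_def by (auto intro: rev_image_eqI)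
  ultimately have coc': "cocone T d (\<lambda>a v. f (c' a v)) H'"
    using coc hom_comp unfolding cocone_def by fastforce
  obtain k where k: "mediating T d c G (\<lambda>a v. f (c' a v)) H' k"
    and uniq: "\<And>k'. mediating T d c G (\<lambda>a v. f (c' a v)) H' k' \<Longrightarrow> \<forall>v\<in>pverts G. k' v = k v"
    using col coc' unfolding is_colimit_def by blast
  have "mediating T d c G c' H (\<lambda>v. g (k v))"
    unfolding mediating_def
  proof (intro conjI ballI)
    show "graph_hom (\<lambda>v. g (k v)) G H"
      unfolding graph_hom_def
    proof (intro conjI ballI subsetI, goal_cases)
      case (1 x)
      then obtain v where v: "v \<in> pverts G" "x = g (k v)" by blast
      then have "k v \<in> f ` pverts H"
        using k by (auto simp: mediating_def graph_hom_def H'_def)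
      then show ?case using v gf by auto
    next
      case (2 e)
      obtain u v where uv: "e = (u, v)" by (cases e)
      then have "(k u, k v) \<in> (\<lambda>(u, v). (f u, f v)) ` parcs H"
        using k 2 by (auto simp: mediating_def graph_hom_def H'_def)
      then obtain x y where xy: "(x, y) \<in> parcs H" "k u = f x" "k v = f y" by auto
      with gf arcs[OF xy(1)] uv show ?case by simp
    qed
    fix a v assume "a \<in> elts T" "v \<in> pverts (ob d a)"
    then show "g (k (c a v)) = c' a v"
      using k coc gf unfolding mediating_def cocone_def graph_hom_def
      by (metis image_subset_iff)
  qed
  moreover have "\<forall>v\<in>pverts G. h' v = g (k v)" if h': "mediating T d c G c' H h'" for h'
  proof -
    have "mediating T d c G (\<lambda>a v. f (c' a v)) H' (\<lambda>v. f (h' v))"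
      using h' unfolding mediating_def graph_hom_def H'_def by (auto intro: rev_image_eqI)
    from uniq[OF this] show ?thesis
      using h' gf unfolding mediating_def graph_hom_def by (metis image_subset_iff)
  qed
  ultimately show ?thesis by blast
qed

definition tree_decomposition ::
  "'t pair_pre_digraph \<Rightarrow> ('t, 'b) diagram \<Rightarrow> 'g pair_pre_digraph \<Rightarrow> bool" where
  "tree_decomposition T d G \<longleftrightarrow>
     undirected_tree T \<and> monic_diagram T d \<and> (\<exists>c. is_colimit T d c G)"

definition decomposition_independence_number ::
  "'t pair_pre_digraph \<Rightarrow> ('t, 'b) diagram \<Rightarrow> int" where
  "decomposition_independence_number T d =
     (MAX t\<in>pverts T. int (independence_number (ob d (Vertex t)))) - 1"

text \<open>
  Up to isomorphism every tree and every bag lives on natural numbers. The set below is nonempty and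
  bounded below by \<open>-1\<close>, so this infimum of integers is a minimum; the same holds for \<open>treewidth\<close>.
  The value \<open>-1\<close> is taken on the empty graph, whence integers.
\<close>

definition tree_independence_number :: "'a pair_pre_digraph \<Rightarrow> int" where
  "tree_independence_number G =
     Inf {decomposition_independence_number T d |(T :: nat pair_pre_digraph) (d :: (nat, nat) diagram).
            tree_decomposition T d G}"

text \<open>
  In the last conjunct \<open>p\<close> ranges over all paths of \<open>T\<close>, given as lists of distinct vertices; in a
  tree there is exactly one between any two vertices.
\<close>

definition bag_decomposition ::
  "'t pair_pre_digraph \<Rightarrow> ('t \<Rightarrow> 'a set) \<Rightarrow> 'a pair_pre_digraph \<Rightarrow> bool" where
  "bag_decomposition T X G \<longleftrightarrow> undirected_tree T \<and>
     (\<Union>t\<in>pverts T. X t) = pverts G \<and>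
     (\<forall>(u, v)\<in>parcs G. \<exists>t\<in>pverts T. u \<in> X t \<and> v \<in> X t) \<and>
     (\<forall>p. vpath p (with_proj T) \<longrightarrow> (\<forall>t\<in>set p. X (hd p) \<inter> X (last p) \<subseteq> X t))"

definition bag_width :: "'t pair_pre_digraph \<Rightarrow> ('t \<Rightarrow> 'a set) \<Rightarrow> int" where
  "bag_width T X = (MAX t\<in>pverts T. int (card (X t))) - 1"

definition treewidth :: "'a pair_pre_digraph \<Rightarrow> int" where
  "treewidth G = Inf {bag_width T X |(T :: nat pair_pre_digraph) X. bag_decomposition T X G}"

definition complemented_treewidth :: "'a pair_pre_digraph \<Rightarrow> int" where
  "complemented_treewidth G = treewidth (complement_graph G)"

end

theory Submission
  imports Defs
begin

text \<open>
  Decompose \<open>G\<close> with a single bag, \<open>G\<close> itself: it shows that the tree independence number of \<open>G\<close> is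
  at most \<open>\<alpha>(G) - 1\<close>. An independent set of \<open>G\<close> is a clique of the complement of \<open>G\<close>, and a clique
  lies in a single bag of every tree decomposition.
\<close>

text \<open>
  Take a bag that contains as much of the clique \<open>C\<close> as possible, and suppose that it misses \<open>v \<in> C\<close>.
  Let \<open>s\<close> be the first vertex on a path from this bag whose bag contains \<open>v\<close>. For every other \<open>u \<in> C\<close>
  in the chosen bag, some bag \<open>r\<close> contains both \<open>u\<close> and \<open>v\<close>; the path from \<open>s\<close> to \<open>r\<close> stays within the
  bags containing \<open>v\<close>, so it extends the first path to a path whose two ends contain \<open>u\<close>. Hence the
  bag of \<open>s\<close> contains \<open>u\<close> and is a better choice.
\<close>

lemma clique_subset_bag:
  assumes dec: "bag_decomposition T X H"
    and C: "finite C" "C \<subseteq> pverts H"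
    and clique: "\<And>u v. u \<in> C \<Longrightarrow> v \<in> C \<Longrightarrow> u \<noteq> v \<Longrightarrow> (u, v) \<in> parcs H"
  shows "\<exists>t\<in>pverts T. C \<subseteq> X t"
proof -
  have cover: "(\<Union>t\<in>pverts T. X t) = pverts H"
    and edge: "\<And>u v. (u, v) \<in> parcs H \<Longrightarrow> \<exists>t\<in>pverts T. u \<in> X t \<and> v \<in> X t"
    and convex: "\<And>p t. vpath p (with_proj T) \<Longrightarrow> t \<in> set p \<Longrightarrow> X (hd p) \<inter> X (last p) \<subseteq> X t"
    using dec unfolding bag_decomposition_def by blast+
  have T: "pair_graph T" "connected (with_proj T)"
    using dec by (auto simp: bag_decomposition_def undirected_tree_def)
  interpret T: pair_graph T by fact
  have sc: "strongly_connected (with_proj T)"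
    using T.symmetric_connected_imp_strongly_connected[OF T.sym_arcs T(2)] .
  have path: "\<exists>p. vpath p (with_proj T) \<and> hd p = x \<and> last p = y"
    if "x \<in> pverts T" "y \<in> pverts T" for x y
    using sc that T.reachable_vpath_conv by (auto simp: strongly_connected_def)
  let ?k = "\<lambda>s. card (X s \<inter> C)"
  have fin: "finite (?k ` pverts T)" using T.pair_finite_verts by simp
  have "pverts T \<noteq> {}" using sc by (auto simp: strongly_connected_def)
  then have "Max (?k ` pverts T) \<in> ?k ` pverts T" using fin by (intro Max_in) auto
  then obtain t where t: "t \<in> pverts T" "?k t = Max (?k ` pverts T)" by auto
  have max: "?k s \<le> ?k t" if "s \<in> pverts T" for s
    unfolding t(2) using fin that by (intro Max_ge) auto
  have "C \<subseteq> X t"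
  proof (rule subsetI, rule ccontr)
    fix v assume v: "v \<in> C" "v \<notin> X t"
    obtain s' where s': "s' \<in> pverts T" "v \<in> X s'" using cover C v by blast
    obtain p where p: "vpath p (with_proj T)" "hd p = t" "last p = s'"
      using path[OF t(1) s'(1)] by blast
    have "p \<noteq> []" using p(1) by auto
    then have "\<exists>s\<in>set p. v \<in> X s" using p(3) s'(2) by (metis last_in_set)
    then obtain ys s zs where split: "p = ys @ s # zs" "v \<in> X s" "\<forall>y\<in>set ys. v \<notin> X y"
      using split_list_first_prop[of p "\<lambda>s. v \<in> X s"] by blast
    have q: "vwalk (ys @ [s]) (with_proj T)" "distinct (ys @ [s])" "hd (ys @ [s]) = t"
      using p split vwalkI_append_l[of "ys @ [s]" zs "with_proj T"]
      by (auto simp: vpath_def hd_append)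
    then have s: "s \<in> pverts T" by (auto simp: vwalk_def)
    have "u \<in> X s" if u: "u \<in> C" "u \<in> X t" for u
    proof -
      have "(u, v) \<in> parcs H" using clique u v by blast
      then obtain r where r: "r \<in> pverts T" "u \<in> X r" "v \<in> X r" using edge by blast
      obtain q' where q': "vpath q' (with_proj T)" "hd q' = s" "last q' = r"
        using path[OF s r(1)] by blast
      have q'_ne: "q' \<noteq> []" using q'(1) by auto
      have q'_v: "v \<in> X x" if "x \<in> set q'" for x
        using convex[OF q'(1) that] q' r split(2) by blast
      have "q' = s # tl q'" using q'_ne q'(2) by (cases q') auto
      \<comment> \<open>The join \<open>\<oplus>\<close> drops the head of its second argument, so
        the shared vertex \<open>s\<close> is kept only once.\<close>
      then have join: "(ys @ [s]) \<oplus> q' = ys @ q'"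
        by (metis append.assoc append_Cons append_Nil vwalk_join_def)
      have "vwalk (ys @ q') (with_proj T)"
        using vwalk_joinI_vwalk'[OF q(1), of q'] q' join by (auto simp: vpath_def)
      \<comment> \<open>The two lists are disjoint: bags along \<open>ys\<close> miss
        \<open>v\<close>, while all bags along \<open>q'\<close> contain it.\<close>
      moreover have "distinct (ys @ q')"
        using q(2) q'(1) q'_v split(3) by (auto simp: vpath_def)
      ultimately have "vpath (ys @ q') (with_proj T)" by blast
      moreover have "hd (ys @ q') = t" "last (ys @ q') = r" "s \<in> set (ys @ q')"
        using q(3) q' q'_ne by (auto simp: hd_append)
      ultimately show ?thesis using convex[of "ys @ q'" s] u r by auto
    qed
    then have "X t \<inter> C \<subset> X s \<inter> C" using v split(2) by blast
    then have "card (X t \<inter> C) < card (X s \<inter> C)" using C(1) by (intro psubset_card_mono) auto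
    then show False using max[OF s] by simp
  qed
  then show ?thesis using t(1) by blast
qed

lemma undirected_tree_single: "undirected_tree \<lparr>pverts = {x}, parcs = {}\<rparr>"
proof -
  let ?T = "\<lparr>pverts = {x}, parcs = {}\<rparr>"
  interpret T: pair_graph ?T by unfold_locales (auto simp: symmetric_def sym_def)
  have "connected (with_proj ?T)"
    by (auto simp: T.connectedI connected_def strongly_connected_def reachable_def)
  moreover have "\<not> T.cycle p" for p
    unfolding T.cycle_def by (cases p) (auto simp: T.awalk_def)
  ultimately show ?thesis by (auto simp: undirected_tree_def T.pair_graph)
qed

text \<open>Makes the set of widths nonempty, so that \<open>Inf\<close> over it lies above every
  common lower bound.\<close>

lemma bag_decomposition_single:
  assumes "parcs H \<subseteq> pverts H \<times> pverts H"
  shows "bag_decomposition \<lparr>pverts = {x}, parcs = {}\<rparr> (\<lambda>_. pverts H) H"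
  using assms undirected_tree_single by (auto simp: bag_decomposition_def)

text \<open>Bags in \<open>tree_independence_number\<close> live on natural numbers, so
  \<open>G\<close> itself can serve as a bag only through a copy along an injection into
  \<open>nat\<close>.\<close>

definition relabel :: "('a \<Rightarrow> 'b) \<Rightarrow> 'a pair_pre_digraph \<Rightarrow> 'b pair_pre_digraph" where
  "relabel f G = \<lparr>pverts = f ` pverts G, parcs = map_prod f f ` parcs G\<rparr>"

lemma pair_graph_relabel:
  assumes "pair_graph G" "inj_on f (pverts G)"
  shows "pair_graph (relabel f G)"
proof -
  interpret G: pair_graph G by fact
  show ?thesis
  proof
    have "(b, a) \<in> parcs (relabel f G)" if "(a, b) \<in> parcs (relabel f G)" for a b
      using that by (force simp: relabel_def dest: G.arcs_symmetric)
    then show "symmetric (with_proj (relabel f G))" by (simp add: symmetric_def sym_def)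
    fix e assume "e \<in> parcs (relabel f G)"
    then obtain u v where uv: "(u, v) \<in> parcs G" "e = (f u, f v)" by (auto simp: relabel_def)
    with G.in_arcsD1[OF uv(1)] G.in_arcsD2[OF uv(1)] G.pair_no_loops[OF uv(1)] assms(2)
    show "fst e \<in> pverts (relabel f G)" "snd e \<in> pverts (relabel f G)" "fst e \<noteq> snd e"
      by (auto simp: relabel_def dest: inj_onD)
  qed (auto simp: relabel_def G.pair_finite_verts G.pair_finite_arcs)
qed

text \<open>A tree without edges leaves \<open>Vertex x\<close> as the only object of \<integral>T.
  A cocone is then one homomorphism out of the bag, and the colimit is the bag up to isomorphism;
  the leg into \<open>G\<close> undoes \<open>f\<close>.\<close>

lemma tree_decomposition_single:
  assumes G: "pair_graph G" and f: "inj_on f (pverts G)"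
  shows "tree_decomposition \<lparr>pverts = {x}, parcs = {}\<rparr> \<lparr>ob = \<lambda>_. relabel f G, mor = m\<rparr> G"
    (is "tree_decomposition ?T ?d G")
proof -
  interpret G: pair_graph G by fact
  let ?g = "inv_into (pverts G) f"
  have elts: "elts ?T = {Vertex x}" by (auto simp: elts_def)
  have gf: "?g (f v) = v" if "v \<in> pverts G" for v using f that by simp
  have "cocone ?T ?d (\<lambda>_. ?g) G"
    using G gf by (auto simp: cocone_def graph_hom_def relabel_def G.in_arcsD1 G.in_arcsD2)
  moreover have "\<exists>h. mediating ?T ?d (\<lambda>_. ?g) G c H h \<and>
      (\<forall>h'. mediating ?T ?d (\<lambda>_. ?g) G c H h' \<longrightarrow> (\<forall>v\<in>pverts G. h' v = h v))"
    if "cocone ?T ?d c H" for c and H :: "nat pair_pre_digraph"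
  \<comment> \<open>The mediating map first carries \<open>G\<close> to the bag by \<open>f\<close>,
    then follows the leg of the given cocone. It is unique because every \<open>v\<close> in
    \<open>G\<close> is the image of \<open>f v\<close> under the leg \<open>?g\<close>.\<close>
  proof (intro exI[of _ "\<lambda>v. c (Vertex x) (f v)"] conjI allI impI ballI)
    show "mediating ?T ?d (\<lambda>_. ?g) G c H (\<lambda>v. c (Vertex x) (f v))"
      using that gf unfolding mediating_def cocone_def elts
      by (fastforce simp: graph_hom_def relabel_def)
    fix h' v assume "mediating ?T ?d (\<lambda>_. ?g) G c H h'" "v \<in> pverts G"
    then show "h' v = c (Vertex x) (f v)"
      using gf by (force simp: mediating_def elts relabel_def)
  qed
  ultimately have "is_colimit ?T ?d (\<lambda>_. ?g) G" by (auto simp: is_colimit_def)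
  moreover have "monic_diagram ?T ?d"
    using pair_graph_relabel[OF G f] by (auto simp: monic_diagram_def)
  ultimately show ?thesis using undirected_tree_single by (auto simp: tree_decomposition_def)
qed

lemma independence_number_attained:
  assumes "finite (pverts G)"
  obtains S where "independent_set G S" "card S = independence_number G"
proof -
  let ?A = "{card S |S. independent_set G S}"
  have "?A \<subseteq> {..card (pverts G)}" using assms by (auto simp: independent_set_def card_mono)
  then have "finite ?A" by (rule finite_subset) simp
  \<comment> \<open>\<open>Max\<close> is meaningful only on a nonempty set; the empty set is
    independent even in the empty graph.\<close>
  moreover have "independent_set G {}" by (simp add: independent_set_def)
  ultimately have "Max ?A \<in> ?A" by (intro Max_in) auto
  with that show thesis by (auto simp: independence_number_def)
qed

text \<open>Supplies the lower bound without which an \<open>Inf\<close> of integers need not lie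
  below the members of its set.\<close>

lemma decomposition_independence_number_ge:
  assumes "undirected_tree T"
  shows "-1 \<le> decomposition_independence_number T d"
proof -
  interpret T: pair_graph T using assms by (simp add: undirected_tree_def)
  obtain t where "t \<in> pverts T"
    using assms by (auto simp: undirected_tree_def connected_def strongly_connected_def)
  then have "int (independence_number (ob d (Vertex t)))
      \<le> (MAX t\<in>pverts T. int (independence_number (ob d (Vertex t))))"
    using T.pair_finite_verts by (intro Max_ge) auto
  then show ?thesis by (simp add: decomposition_independence_number_def)
qed

lemma tree_independence_number_le:
  fixes T :: "nat pair_pre_digraph" and d :: "(nat, nat) diagram"
  assumes "tree_decomposition T d G"
  shows "tree_independence_number G \<le> decomposition_independence_number T d"
  unfolding tree_independence_number_def
proof (rule cInf_lower)
  show "bdd_below {decomposition_independence_number T d |(T :: nat pair_pre_digraph)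
      (d :: (nat, nat) diagram). tree_decomposition T d G}"
    by (rule bdd_belowI[of _ "-1"])
       (auto simp: tree_decomposition_def dest: decomposition_independence_number_ge)
qed (use assms in blast)

text \<open>Some bag contains all of \<open>C\<close>. Bags are finite here, so its
  \<open>card\<close> is not the default 0 and is at least \<open>card C\<close>.\<close>

lemma bag_width_ge_clique:
  assumes dec: "bag_decomposition T X H" and "finite (pverts H)" "C \<subseteq> pverts H"
    and "\<And>u v. u \<in> C \<Longrightarrow> v \<in> C \<Longrightarrow> u \<noteq> v \<Longrightarrow> (u, v) \<in> parcs H"
  shows "int (card C) - 1 \<le> bag_width T X"
proof -
  interpret T: pair_graph T using dec by (simp add: bag_decomposition_def undirected_tree_def)
  obtain t where t: "t \<in> pverts T" "C \<subseteq> X t"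
    using clique_subset_bag[OF dec finite_subset[OF assms(3,2)] assms(3,4)] by blast
  have "X t \<subseteq> pverts H" using dec t by (auto simp: bag_decomposition_def)
  then have "int (card C) \<le> int (card (X t))" using t(2) assms(2)
    by (simp add: card_mono finite_subset)
  also have "\<dots> \<le> (MAX t\<in>pverts T. int (card (X t)))"
    using t T.pair_finite_verts by (intro Max_ge) auto
  finally show ?thesis by (simp add: bag_width_def)
qed

theorem corollary3p4p8:
  fixes G :: "'a pair_pre_digraph"
  assumes "pair_graph G"
  shows "tree_independence_number G \<le> complemented_treewidth G"
proof -
  interpret G: pair_graph G by fact
  let ?H = "complement_graph G"
  obtain f :: "'a \<Rightarrow> nat" where f: "inj_on f (pverts G)"
    using finite_imp_inj_to_nat_seg[OF G.pair_finite_verts] by blast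
  let ?B = "relabel f G"
  obtain S where S: "independent_set ?B S" "card S = independence_number ?B"
    using independence_number_attained[of ?B] G.pair_finite_verts by (auto simp: relabel_def)
  \<comment> \<open>\<open>S\<close> consists of labels. It is pulled back along \<open>f\<close> to
    a set of the same size in \<open>G\<close>, where the complement is taken.\<close>
  then obtain C where C: "C \<subseteq> pverts G" "inj_on f C" "S = f ` C"
    unfolding independent_set_def relabel_def by (auto simp: subset_image_inj)
  \<comment> \<open>An arc of \<open>G\<close> inside \<open>C\<close> would be mapped by
    \<open>f\<close> to an arc of \<open>?B\<close> inside the independent set
    \<open>S\<close>.\<close>
  have clique: "(u, v) \<in> parcs ?H" if "u \<in> C" "v \<in> C" "u \<noteq> v" for u v
    using that S(1) C by (force simp: complement_graph_def independent_set_def relabel_def)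
  have "tree_independence_number G \<le> int (independence_number ?B) - 1"
    using tree_independence_number_le
      [OF tree_decomposition_single[OF assms f, where x = 0 and m = undefined]]
    by (simp add: decomposition_independence_number_def)
  also have "\<dots> = int (card C) - 1" using S(2) C by (simp add: card_image)
  also have "\<dots> \<le> treewidth ?H"
    unfolding treewidth_def
  proof (rule cInf_greatest)
    show "{bag_width T X |(T :: nat pair_pre_digraph) X. bag_decomposition T X ?H} \<noteq> {}"
      using bag_decomposition_single[of ?H] by (fastforce simp: complement_graph_def)
  next
    fix w assume "w \<in> {bag_width T X |(T :: nat pair_pre_digraph) X. bag_decomposition T X ?H}"
    then obtain T :: "nat pair_pre_digraph" and X
      where "w = bag_width T X" "bag_decomposition T X ?H" by blast
    then show "int (card C) - 1 \<le> w"
      using bag_width_ge_clique[of T X ?H C] clique C(1) G.pair_finite_verts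
      by (simp add: complement_graph_def)
  qed
  finally show ?thesis by (simp add: complemented_treewidth_def)
qed

end
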